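(* Let $(X,d)$ be a compact convergence-symmetric metric space and let $(f_n)$ be a uniformly equicontinuous sequence of functions $[a,b]\to X$. Then there is a subsequence $(f_{n_k})$ that converges uniformly (to some function $f:[a,b]\to X$).
   Context: A metric on a non-empty set $X$ is a function $d:X\times X\to[0,\infty)$ with $d(x,y)=0$ iff $x=y$, and $d(x,z)\le d(x,y)+d(y,z)$ for all $x,y,z$; symmetry is NOT assumed. $(X,d)$ is convergence-symmetric if for any two sequences $(p_n),(q_n)$ in $X$, $d(p_n,q_n)\to0$ if and only if $d(q_n,p_n)\to0$. The topology of such a space is the one induced by the symmetric metric $d_{\mathrm{arith}}(x,y)=\frac12(d(x,y)+d(y,x))$; compactness refers to this topology. A sequence of functions $f_n:[a,b]\to X$ is uniformly equicontinuous if for every $\epsilon>0$ there is $\delta>0$ such that $|t-t'|<\delta$ implies $d(f_n(t),f_n(t'))<\epsilon$ for all $n$. $(f_n)$ converges uniformly to $f$ if for every $\epsilon>0$ there is $N$ with $d(f_n(t),f(t))<\epsilon$ for all $n\ge N$ and all $t$ (for convergence-symmetric $d$ this is equivalent to the same condition with $d(f(t),f_n(t))$). *)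

theory Defs
  imports "HOL-Analysis.Analysis"
begin

text \<open>Symmetry of \<open>d\<close> is not assumed. The axioms only concern points of the carrier \<open>X\<close>;
  the values of \<open>d\<close> elsewhere are irrelevant.\<close>

locale asym_metric_space =
  fixes X :: "'a set" and d :: "'a \<Rightarrow> 'a \<Rightarrow> real"
  assumes nonempty: "X \<noteq> {}"
    and nonneg: "\<And>x y. x \<in> X \<Longrightarrow> y \<in> X \<Longrightarrow> 0 \<le> d x y"
    and zero: "\<And>x y. x \<in> X \<Longrightarrow> y \<in> X \<Longrightarrow> d x y = 0 \<longleftrightarrow> x = y"
    and triangle: "\<And>x y z. x \<in> X \<Longrightarrow> y \<in> X \<Longrightarrow> z \<in> X \<Longrightarrow> d x z \<le> d x y + d y z"

definition convergence_symmetric :: "'a set \<Rightarrow> ('a \<Rightarrow> 'a \<Rightarrow> real) \<Rightarrow> bool" where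
  "convergence_symmetric X d \<longleftrightarrow>
     (\<forall>p q :: nat \<Rightarrow> 'a. (\<forall>n. p n \<in> X) \<longrightarrow> (\<forall>n. q n \<in> X) \<longrightarrow>
        ((\<lambda>n. d (p n) (q n)) \<longlonglongrightarrow> 0 \<longleftrightarrow> (\<lambda>n. d (q n) (p n)) \<longlonglongrightarrow> 0))"

text \<open>The value 0 off the carrier is a convention: the library locale \<open>Metric_space\<close> asks for
  nonnegativity on the whole type.\<close>

definition d_arith :: "'a set \<Rightarrow> ('a \<Rightarrow> 'a \<Rightarrow> real) \<Rightarrow> 'a \<Rightarrow> 'a \<Rightarrow> real" where
  "d_arith X d x y = (if x \<in> X \<and> y \<in> X then (d x y + d y x) / 2 else 0)"

lemma (in asym_metric_space) Metric_space_d_arith: "Metric_space X (d_arith X d)"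
proof
  show "0 \<le> d_arith X d x y" for x y
    by (simp add: d_arith_def nonneg)
  show "d_arith X d x y = d_arith X d y x" for x y
    by (simp add: d_arith_def add.commute)
  show "d_arith X d x y = 0 \<longleftrightarrow> x = y" if "x \<in> X" "y \<in> X" for x y
    using that nonneg[of x y] nonneg[of y x] zero[of x y] zero[of y x]
    by (auto simp: d_arith_def)
  show "d_arith X d x z \<le> d_arith X d x y + d_arith X d y z"
    if "x \<in> X" "y \<in> X" "z \<in> X" for x y z
    using that triangle[of x y z] triangle[of z y x] by (simp add: d_arith_def field_simps)
qed

definition asym_topology :: "'a set \<Rightarrow> ('a \<Rightarrow> 'a \<Rightarrow> real) \<Rightarrow> 'a topology" where
  "asym_topology X d = Metric_space.mtopology X (d_arith X d)"

definition uniformly_equicontinuous_seq ::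
  "('a \<Rightarrow> 'a \<Rightarrow> real) \<Rightarrow> real \<Rightarrow> real \<Rightarrow> (nat \<Rightarrow> real \<Rightarrow> 'a) \<Rightarrow> bool" where
  "uniformly_equicontinuous_seq d a b f \<longleftrightarrow>
     (\<forall>\<epsilon>>0. \<exists>\<delta>>0. \<forall>t\<in>{a..b}. \<forall>t'\<in>{a..b}. \<bar>t - t'\<bar> < \<delta> \<longrightarrow>
        (\<forall>n. d (f n t) (f n t') < \<epsilon>))"

definition converges_uniformly ::
  "('a \<Rightarrow> 'a \<Rightarrow> real) \<Rightarrow> real \<Rightarrow> real \<Rightarrow> (nat \<Rightarrow> real \<Rightarrow> 'a) \<Rightarrow> (real \<Rightarrow> 'a) \<Rightarrow> bool" where
  "converges_uniformly d a b f g \<longleftrightarrow>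
     (\<forall>\<epsilon>>0. \<exists>N. \<forall>n\<ge>N. \<forall>t\<in>{a..b}. d (f n t) (g t) < \<epsilon>)"

end

theory Submission
  imports Defs
begin

text \<open>
  Equicontinuity puts \<open>t\<close> and \<open>t'\<close> on the same footing: since \<open>\<bar>t - t'\<bar> < \<delta>\<close> is symmetric, it bounds
  \<open>d (f n t) (f n t')\<close> and \<open>d (f n t') (f n t)\<close> at once, hence also their mean. The sequence is
  therefore equicontinuous for the symmetric metric \<open>d_arith\<close>, whose topology is compact. Conversely,
  \<open>d \<le> 2 * d_arith\<close>, so uniform convergence for \<open>d_arith\<close> gives uniform convergence for \<open>d\<close>. It remains
  to prove the theorem of Arzela and Ascoli for an ordinary compact metric space.

  That proof takes place in the space of bounded functions with the supremum metric, which replaces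
  the usual diagonal argument. A compact metric space is complete and totally bounded. Completeness
  passes to the function space. Total boundedness passes to equicontinuous families: up to a small
  error, a member of the family is determined by its values on a finite net of the domain, rounded to
  a finite net of the target, and there are only finitely many such tables of values
  (\<open>equicontinuous_imp_mtotally_bounded\<close>). Total boundedness then yields a Cauchy subsequence and
  completeness its limit (\<open>equicontinuous_uniformly_convergent_subsequence\<close>).
\<close>

context Metric_space
begin

text \<open>
  Equicontinuity is used only through finite nets: for every \<open>\<epsilon>\<close> finitely many points of the domain
  represent all others, up to \<open>\<epsilon>\<close> and for all members of the family simultaneously. Compactness of the
  domain enters through these nets, compactness of the target through \<open>tb\<close>.
\<close>

lemma equicontinuous_imp_mtotally_bounded:
  assumes tb: "mtotally_bounded M"
    and F: "F \<subseteq> fspace S"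
    and net: "\<And>\<epsilon>. \<epsilon> > 0 \<Longrightarrow>
      \<exists>T. finite T \<and> T \<subseteq> S \<and> (\<forall>s\<in>S. \<exists>t\<in>T. \<forall>h\<in>F. d (h s) (h t) < \<epsilon>)"
  shows "Metric_space.mtotally_bounded (fspace S) (fdist S) F"
proof -
  interpret F: Metric_space "fspace S" "fdist S"
    by (rule Metric_space_funspace)
  show ?thesis
    unfolding F.mtotally_bounded_def
  proof (intro strip)
    fix \<epsilon> :: real
    assume "\<epsilon> > 0"
    \<comment> \<open>Below, two functions are compared along four steps, so each step may cost \<open>\<epsilon> / 5\<close>.\<close>
    then have \<epsilon>5: "\<epsilon> / 5 > 0" by simp
    obtain T where T: "finite T" "T \<subseteq> S"
      and T_net: "\<And>s. s \<in> S \<Longrightarrow> \<exists>t\<in>T. \<forall>h\<in>F. d (h s) (h t) < \<epsilon> / 5"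
      using net[OF \<epsilon>5] by blast
    obtain K where K: "finite K" "K \<subseteq> M" and K_net: "M \<subseteq> (\<Union>x\<in>K. mball x (\<epsilon> / 5))"
      using tb[unfolded mtotally_bounded_def, rule_format, OF \<epsilon>5] by auto
    have "\<forall>y\<in>M. \<exists>x\<in>K. d x y < \<epsilon> / 5"
      using K_net by fastforce
    then obtain c where c: "\<And>y. y \<in> M \<Longrightarrow> c y \<in> K \<and> d (c y) y < \<epsilon> / 5"
      by metis
    define table where "table h = restrict (c \<circ> h) T" for h
    have "table ` F \<subseteq> T \<rightarrow>\<^sub>E K"
      using F T c by (auto simp: table_def fspace_in_M subset_iff)
    then have "finite (table ` F)"
      using T K by (meson finite_PiE finite_subset)
    then obtain G where G: "G \<subseteq> F" "finite G" "table ` F = table ` G"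
      by (metis finite_subset_image order_refl)
    have "h \<in> (\<Union>g\<in>G. F.mball g \<epsilon>)" if h: "h \<in> F" for h
    proof -
      obtain g where g: "g \<in> G" "table h = table g"
        using G h by (metis image_iff)
      then have gF: "g \<in> F" using G by blast
      have fs: "h \<in> fspace S" "g \<in> fspace S"
        using F h gF by auto
      have near: "d (g s) (h s) \<le> 4 * (\<epsilon> / 5)" if s: "s \<in> S" for s
      proof -
        obtain t where t: "t \<in> T" "d (h s) (h t) < \<epsilon> / 5" "d (g s) (g t) < \<epsilon> / 5"
          using T_net[OF s] h gF by blast
        have M: "h s \<in> M" "h t \<in> M" "g s \<in> M" "g t \<in> M"
          using fs s t T by (auto intro: fspace_in_M)
        have eq: "c (h t) = c (g t)"
          using g t by (metis comp_apply restrict_apply' table_def)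
        have cM: "c (g t) \<in> M" using c M K by blast
        have "d (g s) (h s) \<le> d (g s) (g t) + d (g t) (h s)"
          "d (g t) (h s) \<le> d (g t) (c (g t)) + d (c (g t)) (h s)"
          "d (c (g t)) (h s) \<le> d (c (g t)) (h t) + d (h t) (h s)"
          using M cM by (auto intro: triangle)
        then show ?thesis
          using t c[OF M(2)] c[OF M(4)] eq commute[of "h t" "h s"] commute[of "g t" "c (g t)"]
          by auto
      qed
      have "fdist S g h < \<epsilon>"
      proof (cases "S = {}")
        case True
        then show ?thesis using \<open>\<epsilon> > 0\<close> by simp
      next
        case False
        then have "fdist S g h \<le> 4 * (\<epsilon> / 5)"
          using near funspace_mdist_le[OF fs(2,1)] by blast
        then show ?thesis using \<open>\<epsilon> > 0\<close> by simp
      qed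
      then show ?thesis
        using g fs by auto
    qed
    then show "\<exists>G. finite G \<and> G \<subseteq> F \<and> F \<subseteq> (\<Union>g\<in>G. F.mball g \<epsilon>)"
      using G by blast
  qed
qed

lemma equicontinuous_uniformly_convergent_subsequence:
  fixes f :: "nat \<Rightarrow> 'b \<Rightarrow> 'a"
  assumes cpt: "compact_space mtopology"
    and f: "\<And>n. f n \<in> S \<rightarrow> M"
    and net: "\<And>\<epsilon>. \<epsilon> > 0 \<Longrightarrow>
      \<exists>T. finite T \<and> T \<subseteq> S \<and> (\<forall>s\<in>S. \<exists>t\<in>T. \<forall>n. d (f n s) (f n t) < \<epsilon>)"
  shows "\<exists>r g. strict_mono (r :: nat \<Rightarrow> nat) \<and> g \<in> S \<rightarrow> M \<and>
    (\<forall>\<epsilon>>0. \<exists>N. \<forall>k\<ge>N. \<forall>s\<in>S. d (f (r k) s) (g s) < \<epsilon>)"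
proof -
  interpret F: Metric_space "fspace S" "fdist S"
    by (rule Metric_space_funspace)
  have tb: "mtotally_bounded M" and "mcomplete"
    using cpt compact_space_eq_mcomplete_mtotally_bounded by auto
  then have F_complete: "F.mcomplete"
    using mcomplete_funspace[of S] by (simp add: mcomplete_of_def)
  \<comment> \<open>Members of \<open>fspace S\<close> have the default value off \<open>S\<close>, so that the metric separates them.\<close>
  define \<phi> where "\<phi> n = restrict (f n) S" for n
  have \<phi>: "\<phi> n \<in> fspace S" for n
  proof -
    have "\<phi> n ` S \<subseteq> M"
      using f by (auto simp: \<phi>_def Pi_iff)
    moreover from this have "mbounded (\<phi> n ` S)"
      using mtotally_bounded_imp_mbounded[OF tb] mbounded_subset by blast
    ultimately show ?thesis
      by (simp add: fspace_def \<phi>_def)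
  qed
  have "F.mtotally_bounded (range \<phi>)"
  proof (rule equicontinuous_imp_mtotally_bounded[OF tb])
    show "range \<phi> \<subseteq> fspace S"
      using \<phi> by blast
    fix \<epsilon> :: real
    assume "\<epsilon> > 0"
    from net[OF this] obtain T where T: "finite T" "T \<subseteq> S"
      and T_net: "\<And>s. s \<in> S \<Longrightarrow> \<exists>t\<in>T. \<forall>n. d (f n s) (f n t) < \<epsilon>"
      by blast
    have "\<exists>t\<in>T. \<forall>h\<in>range \<phi>. d (h s) (h t) < \<epsilon>" if s: "s \<in> S" for s
    proof -
      obtain t where "t \<in> T" "\<forall>n. d (f n s) (f n t) < \<epsilon>"
        using T_net[OF s] by blast
      then show ?thesis
        using s T by (intro bexI[of _ t]) (auto simp: \<phi>_def)
    qed
    with T show "\<exists>T. finite T \<and> T \<subseteq> S \<and> (\<forall>s\<in>S. \<exists>t\<in>T. \<forall>h\<in>range \<phi>. d (h s) (h t) < \<epsilon>)"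
      by blast
  qed
  then obtain r where r: "strict_mono r" "F.MCauchy (\<phi> \<circ> r)"
    unfolding F.mtotally_bounded_sequentially by blast
  then obtain g where lim: "limitin F.mtopology (\<phi> \<circ> r) g sequentially"
    using F_complete F.mcomplete_def by blast
  then have g: "g \<in> fspace S"
    by (rule F.limitin_mspace)
  have "\<exists>N. \<forall>k\<ge>N. \<forall>s\<in>S. d (f (r k) s) (g s) < \<epsilon>" if "\<epsilon> > 0" for \<epsilon>
  proof -
    obtain N where N: "\<And>k. k \<ge> N \<Longrightarrow> fdist S (\<phi> (r k)) g < \<epsilon>"
      using lim \<open>\<epsilon> > 0\<close> unfolding F.limit_metric_sequentially by (metis comp_apply)
    have "d (f (r k) s) (g s) < \<epsilon>" if "k \<ge> N" "s \<in> S" for k s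
    proof -
      have "d (\<phi> (r k) s) (g s) \<le> fdist S (\<phi> (r k)) g"
        using funspace_mdist_le[OF \<phi> g] \<open>s \<in> S\<close> by blast
      then show ?thesis
        using N[OF \<open>k \<ge> N\<close>] \<open>s \<in> S\<close> by (simp add: \<phi>_def)
    qed
    then show ?thesis by blast
  qed
  moreover have "g \<in> S \<rightarrow> M"
    using g by (auto intro: fspace_in_M)
  ultimately show ?thesis
    using r by blast
qed

end

theorem theorem7p1:
  fixes X :: "'a set" and d :: "'a \<Rightarrow> 'a \<Rightarrow> real"
    and a b :: real and f :: "nat \<Rightarrow> real \<Rightarrow> 'a"
  assumes "asym_metric_space X d"
    and "convergence_symmetric X d"
    and "compact_space (asym_topology X d)"
    and "a \<le> b"
    and "\<And>n. f n \<in> {a..b} \<rightarrow> X"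
    and "uniformly_equicontinuous_seq d a b f"
  shows "\<exists>r g. strict_mono (r :: nat \<Rightarrow> nat) \<and> g \<in> {a..b} \<rightarrow> X \<and>
           converges_uniformly d a b (\<lambda>k. f (r k)) g"
proof -
  interpret A: asym_metric_space X d by fact
  interpret D: Metric_space X "d_arith X d"
    by (rule A.Metric_space_d_arith)
  have fX: "f n t \<in> X" if "t \<in> {a..b}" for n t
    using assms(5) that by blast
  have net: "\<exists>T. finite T \<and> T \<subseteq> {a..b} \<and>
      (\<forall>s\<in>{a..b}. \<exists>t\<in>T. \<forall>n. d_arith X d (f n s) (f n t) < \<epsilon>)" if "\<epsilon> > 0" for \<epsilon>
  proof -
    obtain \<delta> where "\<delta> > 0" and \<delta>: "\<And>t t' n. t \<in> {a..b} \<Longrightarrow> t' \<in> {a..b} \<Longrightarrow> \<bar>t - t'\<bar> < \<delta> \<Longrightarrow>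
        d (f n t) (f n t') < \<epsilon>"
      using assms(6) \<open>\<epsilon> > 0\<close> unfolding uniformly_equicontinuous_seq_def by metis
    obtain T where T: "finite T" "T \<subseteq> {a..b}" "{a..b} \<subseteq> (\<Union>t\<in>T. ball t \<delta>)"
      using seq_compact_imp_totally_bounded[of "{a..b}"] \<open>\<delta> > 0\<close>
      by (metis compact_Icc compact_imp_seq_compact)
    have "\<exists>t\<in>T. \<forall>n. d_arith X d (f n s) (f n t) < \<epsilon>" if s: "s \<in> {a..b}" for s
    proof -
      obtain t where t: "t \<in> T" "\<bar>t - s\<bar> < \<delta>"
        using T s by (auto simp: dist_real_def subset_iff)
      then have tab: "t \<in> {a..b}" using T by blast
      have "d_arith X d (f n s) (f n t) < \<epsilon>" for n
        using \<delta>[of s t n] \<delta>[of t s n] s tab t fX by (simp add: d_arith_def abs_minus_commute)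
      then show ?thesis using t by blast
    qed
    then show ?thesis using T by blast
  qed
  obtain r g where r: "strict_mono (r :: nat \<Rightarrow> nat)" and g: "g \<in> {a..b} \<rightarrow> X"
    and lim: "\<And>\<epsilon>. \<epsilon> > 0 \<Longrightarrow> \<exists>N. \<forall>k\<ge>N. \<forall>s\<in>{a..b}. d_arith X d (f (r k) s) (g s) < \<epsilon>"
    using D.equicontinuous_uniformly_convergent_subsequence[OF _ assms(5) net] assms(3)
    unfolding asym_topology_def by blast
  have bound: "d x y \<le> 2 * d_arith X d x y" if "x \<in> X" "y \<in> X" for x y
    using that A.nonneg[of y x] by (simp add: d_arith_def)
  have "converges_uniformly d a b (\<lambda>k. f (r k)) g"
    unfolding converges_uniformly_def
  proof (intro strip)
    fix \<epsilon> :: real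
    assume "\<epsilon> > 0"
    then obtain N where N: "\<forall>k\<ge>N. \<forall>s\<in>{a..b}. d_arith X d (f (r k) s) (g s) < \<epsilon> / 2"
      using lim[of "\<epsilon> / 2"] by auto
    have "d (f (r k) t) (g t) < \<epsilon>" if "k \<ge> N" "t \<in> {a..b}" for k t
    proof -
      have "g t \<in> X" using g that by blast
      then show ?thesis
        using bound[OF fX[OF that(2)], of "g t" "r k"] N that by fastforce
    qed
    then show "\<exists>N. \<forall>k\<ge>N. \<forall>t\<in>{a..b}. d (f (r k) t) (g t) < \<epsilon>"
      by blast
  qed
  then show ?thesis
    using r g by blast
qed

end
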